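(* Let $\chi^*(\Lambda_0):=\{(M_0,U_1,U_2,\widehat M): u_1u_2\neq0,\ \lambda\neq\pm1\}/C(\mathcal{T}_0)$, where $M_0\in \mathrm{SL}_2(\mathbb{C})$, $U_1=\begin{pmatrix}1&u_1\\ 0&1\end{pmatrix}$, $U_2=\begin{pmatrix}1&0\\ u_2&1\end{pmatrix}$, $\widehat M=\begin{pmatrix}\lambda&0\\ 0&\lambda^{-1}\end{pmatrix}$. The map $T:\chi(\Lambda_0)\to\mathbb{C}^6$ defined by the six coordinates $(\lambda,t_0,t_1,s,x,y)$ is an isomorphism between $\chi^*(\Lambda_0)$ and the open set $s\neq2$, $\lambda\neq\pm1$ in the affine variety $F$.
   Context: $\Lambda_0=\operatorname{diag}(\lambda_0,-\lambda_0)$, $\lambda_0\neq0$, is a fixed diagonal normal form of the leading coefficient at the irregular singularity of a rank 2 $\mathfrak{sl}_2(\mathbb{C})$-connection on $\mathbb{P}_1(\mathbb{C})$ with two regular singular points $0,1$ and an irregular singular point $\infty$. Its centralizer in $\mathrm{SL}_2(\mathbb{C})$ is $C(\Lambda_0)=C(\mathcal{T}_0)=\left\{D_\alpha=\begin{pmatrix}\alpha&0\\ 0&\alpha^{-1}\end{pmatrix}:\alpha\in\mathbb{C}^*\right\}$, where $\mathcal{T}_0$ is the Cartan subalgebra of diagonal matrices. The wild character variety $\chi(\Lambda_0)$ is the set of 4-tuples $(M_0,U_1,U_2,\widehat M)$, with $M_0\in\mathrm{SL}_2(\mathbb{C})$, $U_1$ upper unipotent, $U_2$ lower unipotent (the Stokes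 multipliers) and $\widehat M$ diagonal in $\mathrm{SL}_2(\mathbb{C})$ (the formal monodromy), written as in the claim with $u_1,u_2\in\mathbb{C}$, $\lambda\in\mathbb{C}^*$, modulo simultaneous conjugation by $C(\mathcal{T}_0)$. The matrix $M_1$ is determined by $M_0U_1U_2\widehat M M_1=I$. Coordinates (invariant under $C(\mathcal{T}_0)$): $\lambda$ is the first eigenvalue of $\widehat M$, $t_0=\operatorname{tr}(M_0)$, $t_1=\operatorname{tr}(M_1)$, $s=\operatorname{tr}(U_1U_2)$, $x=\operatorname{tr}(M_0U_1U_2)$, $y=\operatorname{tr}(M_0\widehat M)$. $F$ is the codimension 1 variety, in the six coordinates $(\lambda,t_0,t_1,s,x,y)$ with $\lambda\neq0$, given by $t_1^2-Pt_1+Q=0$, where $$P=t_0(\lambda^{-1}-\lambda+\lambda s)+sy+(\lambda+\lambda^{-1})x,$$ $$Q=t_0^2+s^2+(\lambda+\lambda^{-1})^2+x^2+(\lambda^{-1}-\lambda+\lambda s)^2+y^2+xy(\lambda^{-1}-\lambda+\lambda s).$$ It is a family of cubics parametrized by $(t_0,t_1,\lambda)$.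
   Formalization: The printed P and Q are incomplete and T does not map into the printed F; F is taken with the full Fricke relation: P has the extra term -t0 s(λ+1/λ), and Q the extra terms -t0 s x - t0(λ+1/λ)y - s(λ+1/λ)(1/λ-λ+λs) - 4. *)

theory Defs
  imports "HOL-Analysis.Analysis"
begin

section \<open>Varieties over the complex numbers as spaces with functions\<close>

text \<open>
  An affine space is a type together with a finite set \<open>K\<close> of coordinate functions;
  its polynomial functions form the \<open>\<complex>\<close>-algebra generated by \<open>K\<close>.
\<close>

inductive_set poly_funs :: "('a \<Rightarrow> complex) set \<Rightarrow> ('a \<Rightarrow> complex) set"
  for K :: "('a \<Rightarrow> complex) set" where
  const: "(\<lambda>_. c) \<in> poly_funs K"
| coord: "k \<in> K \<Longrightarrow> k \<in> poly_funs K"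
| add: "f \<in> poly_funs K \<Longrightarrow> g \<in> poly_funs K \<Longrightarrow> (\<lambda>p. f p + g p) \<in> poly_funs K"
| mult: "f \<in> poly_funs K \<Longrightarrow> g \<in> poly_funs K \<Longrightarrow> (\<lambda>p. f p * g p) \<in> poly_funs K"

definition zariski :: "('a \<Rightarrow> complex) set \<Rightarrow> 'a set \<Rightarrow> 'a topology" where
  "zariski K S =
     subtopology (topology_generated_by {{p. f p \<noteq> 0} | f. f \<in> poly_funs K}) S"

definition regular_on :: "('a \<Rightarrow> complex) set \<Rightarrow> 'a set \<Rightarrow> ('a \<Rightarrow> complex) \<Rightarrow> bool" where
  "regular_on K U f \<longleftrightarrow>
     (\<forall>p\<in>U. \<exists>N g h. openin (zariski K U) N \<and> p \<in> N \<and> g \<in> poly_funs K \<and> h \<in> poly_funs K \<and>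
        (\<forall>q\<in>N. h q \<noteq> 0 \<and> f q = g q / h q))"

text \<open>
  A space with functions is a topology with, for every open set, a notion of regular function
  on it. Functions are total; only their values on the open set matter.
\<close>

record 'a fun_space =
  top_of :: "'a topology"
  reg_of :: "'a set \<Rightarrow> ('a \<Rightarrow> complex) \<Rightarrow> bool"

text \<open>The structure of (reduced) quasi-affine variety on a locally closed set.\<close>

definition variety :: "('a \<Rightarrow> complex) set \<Rightarrow> 'a set \<Rightarrow> 'a fun_space" where
  "variety K S = \<lparr>top_of = zariski K S, reg_of = regular_on K\<rparr>"

text \<open>
  The quotient structure on the set of classes: a set of classes is open, and a function on it is
  regular, iff its pull-back along the projection is. For a group action the regular functions
  on the quotient are thus the invariant regular functions.
\<close>

definition quotient_open :: "'a topology \<Rightarrow> ('a \<times> 'a) set \<Rightarrow> 'a set set \<Rightarrow> bool" where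
  "quotient_open X r V \<longleftrightarrow>
     V \<subseteq> topspace X // r \<and> openin X {p \<in> topspace X. r `` {p} \<in> V}"

definition quotient_space :: "'a fun_space \<Rightarrow> ('a \<times> 'a) set \<Rightarrow> 'a set fun_space" where
  "quotient_space X r =
     \<lparr>top_of = topology (quotient_open (top_of X) r),
      reg_of = (\<lambda>V f. reg_of X {p \<in> topspace (top_of X). r `` {p} \<in> V} (\<lambda>p. f (r `` {p})))\<rparr>"

definition variety_iso :: "'a fun_space \<Rightarrow> 'b fun_space \<Rightarrow> ('a \<Rightarrow> 'b) \<Rightarrow> bool" where
  "variety_iso X Y \<phi> \<longleftrightarrow>
     homeomorphic_map (top_of X) (top_of Y) \<phi> \<and>
     (\<forall>V f. openin (top_of Y) V \<longrightarrow>
        (reg_of Y V f \<longleftrightarrow> reg_of X {p \<in> topspace (top_of X). \<phi> p \<in> V} (f \<circ> \<phi>)))"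

lemma topspace_zariski: "topspace (zariski K S) = S"
proof -
  have "UNIV \<in> {{p. f p \<noteq> 0} | f. f \<in> poly_funs K}"
    using poly_funs.const[of 1 K] by (auto intro!: exI[of _ "\<lambda>_. 1"])
  then have "\<Union> {{p. f p \<noteq> 0} | f. f \<in> poly_funs K} = UNIV" by blast
  then show ?thesis by (simp add: zariski_def)
qed

lemma istopology_quotient_open: "istopology (quotient_open X r)"
proof (unfold istopology_def, intro conjI allI impI)
  fix S T assume S: "quotient_open X r S" and T: "quotient_open X r T"
  have "{p \<in> topspace X. r `` {p} \<in> S \<inter> T} =
      {p \<in> topspace X. r `` {p} \<in> S} \<inter> {p \<in> topspace X. r `` {p} \<in> T}" by auto
  then show "quotient_open X r (S \<inter> T)"
    using S T unfolding quotient_open_def by (auto intro: openin_Int)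
next
  fix \<K> assume K: "\<forall>S\<in>\<K>. quotient_open X r S"
  have "{p \<in> topspace X. r `` {p} \<in> \<Union>\<K>} = \<Union> ((\<lambda>S. {p \<in> topspace X. r `` {p} \<in> S}) ` \<K>)" by auto
  then show "quotient_open X r (\<Union>\<K>)"
    using K unfolding quotient_open_def by (auto intro!: openin_Union)
qed

lemma openin_quotient_space:
  "openin (top_of (quotient_space X r)) V \<longleftrightarrow> quotient_open (top_of X) r V"
  by (simp add: quotient_space_def istopology_quotient_open topology_inverse')

lemma topspace_quotient_space:
  "topspace (top_of (quotient_space X r)) = topspace (top_of X) // r"
proof -
  have "{p \<in> topspace (top_of X). r `` {p} \<in> topspace (top_of X) // r} = topspace (top_of X)"
    by (auto intro: quotientI)
  then have "quotient_open (top_of X) r (topspace (top_of X) // r)"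
    by (simp add: quotient_open_def)
  then show ?thesis
    by (metis openin_quotient_space openin_subset openin_topspace quotient_open_def subset_antisym)
qed

section \<open>The wild character variety\<close>

type_synonym mat2 = "complex^2^2"

type_synonym stokes_data = "mat2 \<times> mat2 \<times> mat2 \<times> mat2"

definition mat2 :: "complex \<Rightarrow> complex \<Rightarrow> complex \<Rightarrow> complex \<Rightarrow> mat2" where
  "mat2 a b c d = vector [vector [a, b], vector [c, d]]"

definition SL2 :: "mat2 set" where
  "SL2 = {A. det A = 1}"

definition \<Lambda>0 :: "complex \<Rightarrow> mat2" where
  "\<Lambda>0 l0 = mat2 l0 0 0 (- l0)"

definition centralizer :: "mat2 \<Rightarrow> mat2 set" where
  "centralizer A = {g \<in> SL2. g ** A = A ** g}"

definition wild_data :: "stokes_data set" where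
  "wild_data =
     {(M0, mat2 1 u1 0 1, mat2 1 0 u2 1, mat2 l 0 0 (inverse l)) | M0 u1 u2 l.
        M0 \<in> SL2 \<and> l \<noteq> 0}"

definition wild_data_star :: "stokes_data set" where
  "wild_data_star =
     {(M0, mat2 1 u1 0 1, mat2 1 0 u2 1, mat2 l 0 0 (inverse l)) | M0 u1 u2 l.
        M0 \<in> SL2 \<and> l \<noteq> 0 \<and> u1 * u2 \<noteq> 0 \<and> l \<noteq> 1 \<and> l \<noteq> -1}"

definition conj2 :: "mat2 \<Rightarrow> mat2 \<Rightarrow> mat2" where
  "conj2 g A = g ** A ** matrix_inv g"

definition sim_conj :: "mat2 \<Rightarrow> stokes_data \<Rightarrow> stokes_data" where
  "sim_conj g = (\<lambda>(M0, U1, U2, Mh). (conj2 g M0, conj2 g U1, conj2 g U2, conj2 g Mh))"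

definition sim_conj_rel :: "mat2 \<Rightarrow> (stokes_data \<times> stokes_data) set" where
  "sim_conj_rel L =
     {(p, q). p \<in> wild_data \<and> q \<in> wild_data \<and> (\<exists>g\<in>centralizer L. q = sim_conj g p)}"

definition chi :: "mat2 \<Rightarrow> stokes_data set set" where
  "chi L = wild_data // sim_conj_rel L"

definition chi_star :: "mat2 \<Rightarrow> stokes_data set set" where
  "chi_star L = wild_data_star // sim_conj_rel L"

definition stokes_coords :: "(stokes_data \<Rightarrow> complex) set" where
  "stokes_coords =
     {(\<lambda>(M0, U1, U2, Mh). M0 $ i $ j) | i j. True} \<union> {(\<lambda>(M0, U1, U2, Mh). U1 $ i $ j) | i j. True} \<union>
     {(\<lambda>(M0, U1, U2, Mh). U2 $ i $ j) | i j. True} \<union> {(\<lambda>(M0, U1, U2, Mh). Mh $ i $ j) | i j. True}"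

definition chi_star_space :: "mat2 \<Rightarrow> stokes_data set fun_space" where
  "chi_star_space L = quotient_space (variety stokes_coords wild_data_star) (sim_conj_rel L)"

section \<open>The six coordinates and the family of cubics\<close>

type_synonym c6 = "complex \<times> complex \<times> complex \<times> complex \<times> complex \<times> complex"

text \<open>The solution of \<open>M0 ** U1 ** U2 ** Mh ** M1 = mat 1\<close>.\<close>

definition M1_of :: "stokes_data \<Rightarrow> mat2" where
  "M1_of = (\<lambda>(M0, U1, U2, Mh). matrix_inv (M0 ** U1 ** U2 ** Mh))"

text \<open>The order of the coordinates is \<open>(\<lambda>, t0, t1, s, x, y)\<close>.\<close>

definition T_data :: "stokes_data \<Rightarrow> c6" where
  "T_data = (\<lambda>(M0, U1, U2, Mh).
     (Mh $ 1 $ 1, trace M0, trace (M1_of (M0, U1, U2, Mh)), trace (U1 ** U2),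
      trace (M0 ** U1 ** U2), trace (M0 ** Mh)))"

text \<open>The common value of \<open>T_data\<close> on a class of \<open>chi\<close>.\<close>

definition T_map :: "stokes_data set \<Rightarrow> c6" where
  "T_map c = the_elem (T_data ` c)"

text \<open>
  With \<open>z = tr (U1 U2 Mh) = 1/\<lambda> - \<lambda> + \<lambda> s\<close>, the equation \<open>t1^2 - P t1 + Q = 0\<close> is the Fricke
  relation of the three matrices \<open>M0\<close>, \<open>U1 U2\<close>, \<open>Mh\<close>, with traces \<open>t0\<close>, \<open>s\<close>, \<open>\<lambda> + 1/\<lambda>\<close>, traces of
  products of two \<open>x\<close>, \<open>y\<close>, \<open>z\<close>, and trace of the product of all three \<open>t1\<close>. The source omits
  the last line of each formula; without these terms the image of \<open>T_map\<close> does not lie in \<open>F_cubic\<close>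
  (see \<open>T_data_in_F\<close> and \<open>truncated_relation_fails\<close> below).
\<close>

definition F_P :: "complex \<Rightarrow> complex \<Rightarrow> complex \<Rightarrow> complex \<Rightarrow> complex \<Rightarrow> complex" where
  "F_P l t0 s x y =
     t0 * (inverse l - l + l * s) + s * y + (l + inverse l) * x
     - t0 * s * (l + inverse l)"

definition F_Q :: "complex \<Rightarrow> complex \<Rightarrow> complex \<Rightarrow> complex \<Rightarrow> complex \<Rightarrow> complex" where
  "F_Q l t0 s x y =
     t0^2 + s^2 + (l + inverse l)^2 + x^2 + (inverse l - l + l * s)^2 + y^2
       + x * y * (inverse l - l + l * s)
     - t0 * s * x - t0 * (l + inverse l) * y - s * (l + inverse l) * (inverse l - l + l * s) - 4"

definition F_cubic :: "c6 set" where
  "F_cubic = {(l, t0, t1, s, x, y). l \<noteq> 0 \<and> t1^2 - F_P l t0 s x y * t1 + F_Q l t0 s x y = 0}"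

definition F_star :: "c6 set" where
  "F_star = {(l, t0, t1, s, x, y) \<in> F_cubic. s \<noteq> 2 \<and> l \<noteq> 1 \<and> l \<noteq> -1}"

definition c6_coords :: "(c6 \<Rightarrow> complex) set" where
  "c6_coords =
     {\<lambda>(l, t0, t1, s, x, y). l, \<lambda>(l, t0, t1, s, x, y). t0, \<lambda>(l, t0, t1, s, x, y). t1,
      \<lambda>(l, t0, t1, s, x, y). s, \<lambda>(l, t0, t1, s, x, y). x, \<lambda>(l, t0, t1, s, x, y). y}"

definition F_star_space :: "c6 fun_space" where
  "F_star_space = variety c6_coords F_star"

section \<open>Basic facts\<close>

lemma mat2_nth [simp]:
  "mat2 a b c d $ 1 $ 1 = a" "mat2 a b c d $ 1 $ 2 = b"
  "mat2 a b c d $ 2 $ 1 = c" "mat2 a b c d $ 2 $ 2 = d"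
  by (simp_all add: mat2_def)

lemma mat2_eta: "A = mat2 (A$1$1) (A$1$2) (A$2$1) (A$2$2)"
  by (simp add: vec_eq_iff forall_2)

lemma mat2_eq_iff [simp]:
  "mat2 a b c d = mat2 a' b' c' d' \<longleftrightarrow> a = a' \<and> b = b' \<and> c = c' \<and> d = d'"
  by (metis mat2_nth)

lemma mat2_mult [simp]:
  "mat2 a b c d ** mat2 a' b' c' d' =
     mat2 (a*a' + b*c') (a*b' + b*d') (c*a' + d*c') (c*b' + d*d')"
  by (simp add: vec_eq_iff forall_2 matrix_matrix_mult_def sum_2)

lemma mat2_one: "mat 1 = mat2 1 0 0 1"
  by (simp add: vec_eq_iff forall_2 mat_def)

lemma det_mat2 [simp]: "det (mat2 a b c d) = a * d - b * c"
  by (simp add: det_2)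

lemma trace_mat2 [simp]: "trace (mat2 a b c d) = a + d"
  by (simp add: trace_def sum_2)

lemma matrix_inv_mat2 [simp]:
  assumes "a * d - b * c = 1"
  shows "matrix_inv (mat2 a b c d) = mat2 d (-b) (-c) a"
proof -
  have 1: "mat2 a b c d ** mat2 d (-b) (-c) a = mat 1"
    and 2: "mat2 d (-b) (-c) a ** mat2 a b c d = mat 1"
    using assms by (simp_all add: mat2_one algebra_simps)
  have "mat2 a b c d ** matrix_inv (mat2 a b c d) = mat 1"
    unfolding matrix_inv_def using someI[of "\<lambda>B. mat2 a b c d ** B = mat 1 \<and> B ** mat2 a b c d = mat 1"] 1 2
    by blast
  then show ?thesis by (metis 2 matrix_mul_assoc matrix_mul_lid matrix_mul_rid)
qed

lemma centralizer_\<Lambda>0: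
  assumes "l0 \<noteq> 0"
  shows "centralizer (\<Lambda>0 l0) = {mat2 \<alpha> 0 0 (inverse \<alpha>) | \<alpha>. \<alpha> \<noteq> 0}"
proof (intro equalityI subsetI)
  fix g assume g: "g \<in> centralizer (\<Lambda>0 l0)"
  obtain a b c d where gd: "g = mat2 a b c d" using mat2_eta by blast
  have "b * l0 = 0" "c * l0 = 0" "a * d - b * c = 1"
    using g unfolding gd centralizer_def \<Lambda>0_def SL2_def by (auto simp: algebra_simps)
  with assms have "b = 0" "c = 0" "a * d = 1" by auto
  then have "a \<noteq> 0" "d = inverse a" by (auto simp: inverse_unique)
  then show "g \<in> {mat2 \<alpha> 0 0 (inverse \<alpha>) | \<alpha>. \<alpha> \<noteq> 0}"
    using gd \<open>b = 0\<close> \<open>c = 0\<close> by blast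
next
  fix g assume "g \<in> {mat2 \<alpha> 0 0 (inverse \<alpha>) | \<alpha>. \<alpha> \<noteq> 0}"
  then show "g \<in> centralizer (\<Lambda>0 l0)"
    unfolding centralizer_def \<Lambda>0_def SL2_def by auto
qed

lemma conj2_torus:
  assumes "\<alpha> \<noteq> 0"
  shows "conj2 (mat2 \<alpha> 0 0 (inverse \<alpha>)) (mat2 a b c d) = mat2 a (\<alpha>^2 * b) (inverse \<alpha>^2 * c) d"
  using assms by (simp add: conj2_def power2_eq_square)

lemma sim_conj_torus:
  assumes "\<alpha> \<noteq> 0"
  shows "sim_conj (mat2 \<alpha> 0 0 (inverse \<alpha>))
      (mat2 a b c d, mat2 1 u1 0 1, mat2 1 0 u2 1, mat2 l 0 0 (inverse l)) =
     (mat2 a (\<alpha>^2 * b) (inverse \<alpha>^2 * c) d, mat2 1 (\<alpha>^2 * u1) 0 1,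
      mat2 1 0 (inverse \<alpha>^2 * u2) 1, mat2 l 0 0 (inverse l))"
  using assms by (simp add: sim_conj_def conj2_torus)

lemma wild_dataE:
  assumes "p \<in> wild_data"
  obtains a b c d u1 u2 l where "a * d - b * c = 1" "l \<noteq> 0"
    "p = (mat2 a b c d, mat2 1 u1 0 1, mat2 1 0 u2 1, mat2 l 0 0 (inverse l))"
proof -
  obtain M0 u1 u2 l where *: "det M0 = 1" "l \<noteq> 0"
    "p = (M0, mat2 1 u1 0 1, mat2 1 0 u2 1, mat2 l 0 0 (inverse l))"
    using assms by (auto simp: wild_data_def SL2_def)
  obtain a b c d where "M0 = mat2 a b c d" using mat2_eta by blast
  with * that show ?thesis by auto
qed

lemma T_data_mat2:
  assumes "a * d - b * c = 1" "l \<noteq> 0"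
  shows "T_data (mat2 a b c d, mat2 1 u1 0 1, mat2 1 0 u2 1, mat2 l 0 0 (inverse l)) =
    (l, a + d, l * (a * (1 + u1 * u2) + b * u2) + inverse l * (c * u1 + d), 2 + u1 * u2,
     a * (1 + u1 * u2) + b * u2 + c * u1 + d, a * l + d * inverse l)"
proof -
  define k where "k = inverse l"
  have lk: "l * k = 1" using assms by (simp add: k_def)
  define m where "m = mat2 ((a * (1 + u1 * u2) + b * u2) * l) ((a * u1 + b) * k)
      ((c * (1 + u1 * u2) + d * u2) * l) ((c * u1 + d) * k)"
  have "mat2 a b c d ** mat2 1 u1 0 1 ** mat2 1 0 u2 1 ** mat2 l 0 0 k = m"
    by (simp add: m_def algebra_simps)
  moreover have "((a * (1 + u1 * u2) + b * u2) * l) * ((c * u1 + d) * k)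
      - ((a * u1 + b) * k) * ((c * (1 + u1 * u2) + d * u2) * l) = 1"
    using assms(1) lk by algebra
  then have "trace (matrix_inv m) = l * (a * (1 + u1 * u2) + b * u2) + k * (c * u1 + d)"
    unfolding m_def by (subst matrix_inv_mat2) (simp_all add: mult_ac)
  ultimately show ?thesis
    unfolding T_data_def M1_of_def k_def[symmetric] by (simp add: algebra_simps)
qed

lemma sim_conj_relE:
  assumes "l0 \<noteq> 0" "(p, q) \<in> sim_conj_rel (\<Lambda>0 l0)"
  obtains a b c d u1 u2 l \<alpha> where "a * d - b * c = 1" "l \<noteq> 0" "\<alpha> \<noteq> 0"
    "p = (mat2 a b c d, mat2 1 u1 0 1, mat2 1 0 u2 1, mat2 l 0 0 (inverse l))"
    "q = (mat2 a (\<alpha>^2 * b) (inverse \<alpha>^2 * c) d, mat2 1 (\<alpha>^2 * u1) 0 1,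
          mat2 1 0 (inverse \<alpha>^2 * u2) 1, mat2 l 0 0 (inverse l))"
proof -
  obtain \<alpha> where *: "p \<in> wild_data" "\<alpha> \<noteq> 0" "q = sim_conj (mat2 \<alpha> 0 0 (inverse \<alpha>)) p"
    using assms by (auto simp: sim_conj_rel_def centralizer_\<Lambda>0)
  show ?thesis
    by (rule wild_dataE[OF *(1)], rule that) (use * in \<open>auto simp: sim_conj_torus\<close>)
qed

lemma sim_conj_relI:
  assumes "l0 \<noteq> 0" "a * d - b * c = 1" "l \<noteq> 0" "\<alpha> \<noteq> 0"
  shows "((mat2 a b c d, mat2 1 u1 0 1, mat2 1 0 u2 1, mat2 l 0 0 (inverse l)),
    (mat2 a (\<alpha>^2 * b) (inverse \<alpha>^2 * c) d, mat2 1 (\<alpha>^2 * u1) 0 1,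
     mat2 1 0 (inverse \<alpha>^2 * u2) 1, mat2 l 0 0 (inverse l))) \<in> sim_conj_rel (\<Lambda>0 l0)"
    (is "(?p, ?q) \<in> _")
proof -
  have "\<alpha>^2 * b * (inverse \<alpha>^2 * c) = b * c"
    using assms by (simp add: field_simps)
  then have "mat2 a (\<alpha>^2 * b) (inverse \<alpha>^2 * c) d \<in> SL2" "mat2 a b c d \<in> SL2"
    using assms by (simp_all only: SL2_def det_mat2 mem_Collect_eq)
  then have "?p \<in> wild_data" "?q \<in> wild_data"
    unfolding wild_data_def using assms(3) by blast+
  moreover have "mat2 \<alpha> 0 0 (inverse \<alpha>) \<in> centralizer (\<Lambda>0 l0)"
    using assms by (auto simp: centralizer_\<Lambda>0)
  ultimately show ?thesis
    unfolding sim_conj_rel_def mem_Collect_eq case_prod_conv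
    using sim_conj_torus[OF assms(4), of a b c d u1 u2 l, symmetric] by blast
qed

lemma equiv_sim_conj_rel:
  assumes l0: "l0 \<noteq> 0"
  shows "equiv wild_data (sim_conj_rel (\<Lambda>0 l0))"
proof (rule equivI)
  show "sim_conj_rel (\<Lambda>0 l0) \<subseteq> wild_data \<times> wild_data"
    by (auto simp: sim_conj_rel_def)
  show "refl_on wild_data (sim_conj_rel (\<Lambda>0 l0))"
  proof (rule refl_onI)
    fix p assume "p \<in> wild_data"
    then show "(p, p) \<in> sim_conj_rel (\<Lambda>0 l0)"
      by (rule wild_dataE) (use sim_conj_relI[OF l0, where \<alpha> = 1] in simp)
  qed
  show "sym (sim_conj_rel (\<Lambda>0 l0))"
  proof (rule symI)
    fix p q assume "(p, q) \<in> sim_conj_rel (\<Lambda>0 l0)"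
    then show "(q, p) \<in> sim_conj_rel (\<Lambda>0 l0)"
    proof (rule sim_conj_relE[OF l0], goal_cases)
      case (1 a b c d u1 u2 l \<alpha>)
      then show ?case
        using sim_conj_relI[OF l0, of a d "\<alpha>^2 * b" "inverse \<alpha>^2 * c" l "inverse \<alpha>"
            "\<alpha>^2 * u1" "inverse \<alpha>^2 * u2"]
        by (simp add: field_simps)
    qed
  qed
  show "trans (sim_conj_rel (\<Lambda>0 l0))"
  proof (rule transI)
    fix p q r assume pq: "(p, q) \<in> sim_conj_rel (\<Lambda>0 l0)" and qr: "(q, r) \<in> sim_conj_rel (\<Lambda>0 l0)"
    from pq show "(p, r) \<in> sim_conj_rel (\<Lambda>0 l0)"
    proof (rule sim_conj_relE[OF l0], goal_cases)
      case p: (1 a b c d u1 u2 l \<alpha>)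
      from qr show ?case
      proof (rule sim_conj_relE[OF l0], goal_cases)
        case (1 a' b' c' d' v1 v2 l' \<beta>)
        with p show ?case
          using sim_conj_relI[OF l0, of a d b c l "\<alpha> * \<beta>" u1 u2]
          by (simp add: power_mult_distrib mult_ac)
      qed
    qed
  qed
qed

lemma T_data_respects:
  assumes l0: "l0 \<noteq> 0"
  shows "T_data respects sim_conj_rel (\<Lambda>0 l0)"
proof (rule congruentI)
  fix p q assume "(p, q) \<in> sim_conj_rel (\<Lambda>0 l0)"
  then show "T_data p = T_data q"
  proof (rule sim_conj_relE[OF l0], goal_cases)
    case (1 a b c d u1 u2 l \<alpha>)
    have "a * d - \<alpha>^2 * b * (inverse \<alpha>^2 * c) = 1"
      using 1 by (simp add: field_simps)
    moreover have "\<alpha>^2 * u1 * (inverse \<alpha>^2 * u2) = u1 * u2"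
      "\<alpha>^2 * b * (inverse \<alpha>^2 * u2) = b * u2" "inverse \<alpha>^2 * c * (\<alpha>^2 * u1) = c * u1"
      using 1 by (simp_all add: field_simps)
    ultimately show ?case
      unfolding 1(4,5) T_data_mat2[OF 1(1,2)]
      by (subst T_data_mat2) (simp_all only: 1(2) not_False_eq_True)
  qed
qed

lemma T_class:
  assumes "l0 \<noteq> 0" "p \<in> wild_data"
  shows "T_map (sim_conj_rel (\<Lambda>0 l0) `` {p}) = T_data p"
proof -
  have "p \<in> sim_conj_rel (\<Lambda>0 l0) `` {p}"
    using equiv_class_self[OF equiv_sim_conj_rel] assms by blast
  moreover have "\<And>q. q \<in> sim_conj_rel (\<Lambda>0 l0) `` {p} \<Longrightarrow> T_data q = T_data p"
    using congruentD[OF T_data_respects[OF assms(1)]] by (metis Image_singleton_iff)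
  ultimately have "T_data ` (sim_conj_rel (\<Lambda>0 l0) `` {p}) = {T_data p}" by blast
  then show ?thesis by (simp only: T_map_def the_elem_eq)
qed

lemma chi_star_subset_chi: "chi_star L \<subseteq> chi L"
  unfolding chi_star_def chi_def wild_data_star_def wild_data_def quotient_def by blast

lemma topspace_chi_star_space: "topspace (top_of (chi_star_space L)) = chi_star L"
  by (simp add: chi_star_space_def chi_star_def topspace_quotient_space variety_def topspace_zariski)

lemma topspace_F_star_space: "topspace (top_of F_star_space) = F_star"
  by (simp add: F_star_space_def variety_def topspace_zariski)

lemma T_data_in_F:
  assumes "p \<in> wild_data"
  shows "T_data p \<in> F_cubic"
  using assms
proof (rule wild_dataE)
  fix a b c d u1 u2 l :: complex
  assume h: "a * d - b * c = 1" "l \<noteq> 0"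
    and p: "p = (mat2 a b c d, mat2 1 u1 0 1, mat2 1 0 u2 1, mat2 l 0 0 (inverse l))"
  define k where "k = inverse l"
  have lk: "l * k = 1" using h by (simp add: k_def)
  define t0 t1 s x y where "t0 = a + d" and "t1 = l * (a * (1 + u1 * u2) + b * u2) + k * (c * u1 + d)"
    and "s = 2 + u1 * u2" and "x = a * (1 + u1 * u2) + b * u2 + c * u1 + d" and "y = a * l + d * k"
  note defs = this
  have "t1^2 - (t0 * (k - l + l * s) + s * y + (l + k) * x - t0 * s * (l + k)) * t1
     + (t0^2 + s^2 + (l + k)^2 + x^2 + (k - l + l * s)^2 + y^2 + x * y * (k - l + l * s)
     - t0 * s * x - t0 * (l + k) * y - s * (l + k) * (k - l + l * s) - 4) = 0"
    using h(1) lk unfolding defs by algebra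
  moreover have "T_data p = (l, t0, t1, s, x, y)"
    unfolding p defs k_def by (rule T_data_mat2[OF h])
  ultimately show "T_data p \<in> F_cubic"
    using h(2) by (simp only: F_cubic_def F_P_def F_Q_def k_def mem_Collect_eq case_prod_conv) blast
qed

lemma truncated_relation_fails:
  obtains p l t0 t1 s x y where "p \<in> wild_data_star" "T_data p = (l, t0, t1, s, x, y)"
    "t1^2 - (t0 * (inverse l - l + l * s) + s * y + (l + inverse l) * x) * t1
      + (t0^2 + s^2 + (l + inverse l)^2 + x^2 + (inverse l - l + l * s)^2 + y^2
         + x * y * (inverse l - l + l * s)) \<noteq> 0"
proof -
  let ?p = "(mat2 1 0 0 1, mat2 1 1 0 1, mat2 1 0 (-1) 1, mat2 2 0 0 (inverse 2))"
  have "?p \<in> wild_data_star"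
    unfolding wild_data_star_def SL2_def by fastforce
  moreover have "T_data ?p = (2, 2, 1/2, 1, 1, 5/2)"
    using T_data_mat2[of 1 1 0 0 2 1 "-1"] by simp
  ultimately show ?thesis
    by (rule that) (simp add: power2_eq_square)
qed

end

theory Submission
  imports Defs
begin

text \<open>
  The torus \<open>C(\<Lambda>0)\<close> acts on \<open>wild_data_star\<close> by scaling \<open>u1\<close>, the entry \<open>b\<close> of \<open>M0\<close> and the
  inverses of \<open>u2\<close> and \<open>c\<close> by the same square. As \<open>u1 \<noteq> 0\<close> and every nonzero complex number is a
  square, each orbit contains a point with \<open>u1 = 1\<close>, and this point can be computed from the six
  coordinates: \<open>u2 = s - 2\<close>, the diagonal entries \<open>a\<close>, \<open>d\<close> of \<open>M0\<close> solve the linear system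
  \<open>a + d = t0\<close>, \<open>l a + d / l = y\<close>, and the products \<open>B = b u2\<close>, \<open>C = c u1\<close> then solve a linear
  system with the same matrix and right-hand sides built from \<open>x\<close> and \<open>t1\<close>. Its determinant
  is nonzero exactly when \<open>l \<noteq> 1\<close> and \<open>l \<noteq> -1\<close>. In the unknowns \<open>a\<close>, \<open>d\<close>, \<open>B\<close>, \<open>C\<close> the cubic
  equation becomes
  \<open>(l - 1/l)\<^sup>2 (B C - (s - 2) (a d - 1)) = 0\<close> (\<open>fricke_factorization\<close>), which says that \<open>M0\<close> has
  determinant 1. Hence \<open>T_data\<close> has a section \<open>stokes_section\<close> over \<open>F_star\<close>, given by quotients
  of polynomials with nowhere vanishing denominators, and the section meets every orbit exactly
  once.

  The rest is formal. A map whose coordinates are such quotients is Zariski continuous and pulls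
  regular functions back to regular functions (\<open>continuous_map_zariski\<close>, \<open>regular_on_pullback\<close>).
  An invariant map with a section of this kind that meets every class induces an isomorphism
  from the quotient to its image (\<open>variety_iso_quotient_section\<close>).
\<close>

section \<open>Maps given by quotients of polynomials\<close>

text \<open>One fraction is required to work on all of \<open>S\<close>; this is stronger than \<open>regular_on\<close>, and makes
  the notion closed under composition by a mere induction over polynomials.\<close>

definition rational_on :: "('a \<Rightarrow> complex) set \<Rightarrow> 'a set \<Rightarrow> ('a \<Rightarrow> complex) \<Rightarrow> bool" where
  "rational_on K S f \<longleftrightarrow>
     (\<exists>g\<in>poly_funs K. \<exists>h\<in>poly_funs K. \<forall>p\<in>S. h p \<noteq> 0 \<and> f p = g p / h p)"

lemma rational_on_poly:
  assumes "f \<in> poly_funs K"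
  shows "rational_on K S f"
  unfolding rational_on_def
  by (rule bexI[OF _ assms], rule bexI[OF _ poly_funs.const[of 1]]) simp

lemma rational_on_const: "rational_on K S (\<lambda>_. c)"
  by (intro rational_on_poly poly_funs.const)

lemma rational_on_coord: "k \<in> K \<Longrightarrow> rational_on K S k"
  by (intro rational_on_poly poly_funs.coord)

lemma rational_on_cong:
  assumes "\<And>p. p \<in> S \<Longrightarrow> f p = g p"
  shows "rational_on K S f \<longleftrightarrow> rational_on K S g"
  using assms unfolding rational_on_def by (simp cong: ball_cong)

lemma rational_on_subset: "rational_on K S f \<Longrightarrow> S' \<subseteq> S \<Longrightarrow> rational_on K S' f"
  unfolding rational_on_def by blast

lemma rational_on_mult:
  assumes "rational_on K S f" "rational_on K S f'"
  shows "rational_on K S (\<lambda>p. f p * f' p)"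
proof -
  obtain g h g' h' where "g \<in> poly_funs K" "h \<in> poly_funs K" "g' \<in> poly_funs K" "h' \<in> poly_funs K"
    and "\<forall>p\<in>S. h p \<noteq> 0 \<and> f p = g p / h p" "\<forall>p\<in>S. h' p \<noteq> 0 \<and> f' p = g' p / h' p"
    using assms unfolding rational_on_def by blast
  then show ?thesis
    unfolding rational_on_def
    by (intro bexI[of _ "\<lambda>p. g p * g' p"] bexI[of _ "\<lambda>p. h p * h' p"] poly_funs.mult) auto
qed

lemma rational_on_add:
  assumes "rational_on K S f" "rational_on K S f'"
  shows "rational_on K S (\<lambda>p. f p + f' p)"
proof -
  obtain g h g' h' where "g \<in> poly_funs K" "h \<in> poly_funs K" "g' \<in> poly_funs K" "h' \<in> poly_funs K"
    and "\<forall>p\<in>S. h p \<noteq> 0 \<and> f p = g p / h p" "\<forall>p\<in>S. h' p \<noteq> 0 \<and> f' p = g' p / h' p"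
    using assms unfolding rational_on_def by blast
  then show ?thesis
    unfolding rational_on_def
    by (intro bexI[of _ "\<lambda>p. g p * h' p + g' p * h p"] bexI[of _ "\<lambda>p. h p * h' p"]
        poly_funs.mult poly_funs.add) (auto simp: add_frac_eq)
qed

lemma rational_on_diff:
  assumes "rational_on K S f" "rational_on K S f'"
  shows "rational_on K S (\<lambda>p. f p - f' p)"
  using rational_on_add[OF assms(1) rational_on_mult[OF rational_on_const[of K S "-1"] assms(2)]]
  by simp

lemma rational_on_inverse:
  assumes "rational_on K S f" "\<And>p. p \<in> S \<Longrightarrow> f p \<noteq> 0"
  shows "rational_on K S (\<lambda>p. inverse (f p))"
proof -
  obtain g h where "g \<in> poly_funs K" "h \<in> poly_funs K" "\<forall>p\<in>S. h p \<noteq> 0 \<and> f p = g p / h p"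
    using assms(1) unfolding rational_on_def by blast
  with assms(2) show ?thesis
    unfolding rational_on_def by (intro bexI[of _ h] bexI[of _ g]) auto
qed

lemma rational_on_divide:
  assumes "rational_on K S f" "rational_on K S f'" "\<And>p. p \<in> S \<Longrightarrow> f' p \<noteq> 0"
  shows "rational_on K S (\<lambda>p. f p / f' p)"
  unfolding divide_inverse using assms by (intro rational_on_mult rational_on_inverse)

lemmas rational_on_intros =
  rational_on_const rational_on_add rational_on_diff rational_on_mult

definition rational_map_on ::
    "('a \<Rightarrow> complex) set \<Rightarrow> 'a set \<Rightarrow> ('b \<Rightarrow> complex) set \<Rightarrow> ('a \<Rightarrow> 'b) \<Rightarrow> bool" where
  "rational_map_on K S L \<phi> \<longleftrightarrow> (\<forall>k\<in>L. rational_on K S (\<lambda>p. k (\<phi> p)))"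

lemma rational_map_on_subset: "rational_map_on K S L \<phi> \<Longrightarrow> S' \<subseteq> S \<Longrightarrow> rational_map_on K S' L \<phi>"
  unfolding rational_map_on_def using rational_on_subset by blast

lemma rational_on_poly_comp:
  assumes "rational_map_on K S L \<phi>" "f \<in> poly_funs L"
  shows "rational_on K S (\<lambda>p. f (\<phi> p))"
  using assms(2)
proof induction
  case (coord k)
  then show ?case using assms(1) by (simp add: rational_map_on_def)
qed (intro rational_on_intros; assumption)+

text \<open>The preimage of a basic open set \<open>f \<noteq> 0\<close> is the nonvanishing set of the numerator of the
  pulled back fraction.\<close>

lemma continuous_map_zariski:
  assumes rat: "rational_map_on K S L \<phi>" and maps: "\<phi> ` S \<subseteq> S'"
  shows "continuous_map (zariski K S) (zariski L S') \<phi>"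
proof -
  let ?B = "{{p. f p \<noteq> 0} | f. f \<in> poly_funs L}"
  have "openin (zariski K S) (\<phi> -` U \<inter> S)" if "U \<in> ?B" for U
  proof -
    from that obtain f where f: "f \<in> poly_funs L" "U = {p. f p \<noteq> 0}" by blast
    obtain g h where g: "g \<in> poly_funs K" and gh: "\<forall>p\<in>S. h p \<noteq> 0 \<and> f (\<phi> p) = g p / h p"
      using rational_on_poly_comp[OF rat f(1)] unfolding rational_on_def by blast
    have "\<phi> -` U \<inter> S = {p. g p \<noteq> 0} \<inter> S"
      using gh by (auto simp: f(2))
    moreover have "openin (topology_generated_by {{p. f p \<noteq> 0} | f. f \<in> poly_funs K}) {p. g p \<noteq> 0}"
      using g by (intro topology_generated_by_Basis) blast
    ultimately show ?thesis
      unfolding zariski_def openin_subtopology by blast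
  qed
  moreover have "\<Union>?B = UNIV"
    using topspace_zariski[of L UNIV] unfolding zariski_def by simp
  ultimately have "continuous_map (zariski K S) (topology_generated_by ?B) \<phi>"
    unfolding continuous_on_generated_topo_iff by (simp add: topspace_zariski)
  then show ?thesis
    unfolding zariski_def[of L] continuous_map_in_subtopology
    using maps by (auto simp: topspace_zariski)
qed

lemma regular_on_cong:
  assumes eq: "\<And>p. p \<in> U \<Longrightarrow> f p = g p"
  shows "regular_on K U f \<longleftrightarrow> regular_on K U g"
proof -
  have regular: "regular_on K U f'"
    if "regular_on K U f" and eq: "\<And>p. p \<in> U \<Longrightarrow> f p = f' p" for f f'
    unfolding regular_on_def
  proof
    fix p assume "p \<in> U"
    then obtain N g h where N: "openin (zariski K U) N" "p \<in> N" "g \<in> poly_funs K"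
      "h \<in> poly_funs K" "\<forall>q\<in>N. h q \<noteq> 0 \<and> f q = g q / h q"
      using \<open>regular_on K U f\<close> unfolding regular_on_def by blast
    moreover have "N \<subseteq> U"
      using openin_subset[OF N(1)] by (simp add: topspace_zariski)
    ultimately have "\<forall>q\<in>N. h q \<noteq> 0 \<and> f' q = g q / h q"
      using eq by (metis subsetD)
    with N show "\<exists>N g h. openin (zariski K U) N \<and> p \<in> N \<and> g \<in> poly_funs K \<and> h \<in> poly_funs K \<and>
        (\<forall>q\<in>N. h q \<noteq> 0 \<and> f' q = g q / h q)"
      by blast
  qed
  show ?thesis
    using regular[of f g] regular[of g f] eq by auto
qed

text \<open>A local fraction \<open>g / h\<close> pulls back to a quotient of two fractions, whose numerators and
  denominators recombine to a single one.\<close>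

lemma regular_on_pullback:
  assumes rat: "rational_map_on K S L \<phi>" and reg: "regular_on L V f"
  shows "regular_on K {p \<in> S. \<phi> p \<in> V} (f \<circ> \<phi>)"
  unfolding regular_on_def
proof
  let ?U = "{p \<in> S. \<phi> p \<in> V}"
  have ratU: "rational_map_on K ?U L \<phi>"
    using rat by (rule rational_map_on_subset) blast
  fix p assume p: "p \<in> ?U"
  then obtain N g h where N: "openin (zariski L V) N" "\<phi> p \<in> N"
    and gh: "g \<in> poly_funs L" "h \<in> poly_funs L" "\<forall>q\<in>N. h q \<noteq> 0 \<and> f q = g q / h q"
    using reg unfolding regular_on_def by blast
  let ?N = "{q \<in> ?U. \<phi> q \<in> N}"
  have open_N: "openin (zariski K ?U) ?N"
    using openin_continuous_map_preimage[OF continuous_map_zariski[OF ratU, of V] N(1)]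
    by (auto simp: topspace_zariski)
  have "rational_on K ?N (\<lambda>q. g (\<phi> q) / h (\<phi> q))"
  proof (rule rational_on_divide)
    have ratN: "rational_map_on K ?N L \<phi>"
      using rat by (rule rational_map_on_subset) blast
    show "rational_on K ?N (\<lambda>q. g (\<phi> q))" "rational_on K ?N (\<lambda>q. h (\<phi> q))"
      by (rule rational_on_poly_comp[OF ratN gh(1)], rule rational_on_poly_comp[OF ratN gh(2)])
  qed (use gh(3) in auto)
  then obtain g' h' where "g' \<in> poly_funs K" "h' \<in> poly_funs K"
    "\<forall>q\<in>?N. h' q \<noteq> 0 \<and> g (\<phi> q) / h (\<phi> q) = g' q / h' q"
    unfolding rational_on_def by blast
  then show "\<exists>N g h. openin (zariski K ?U) N \<and> p \<in> N \<and> g \<in> poly_funs K \<and> h \<in> poly_funs K \<and>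
      (\<forall>q\<in>N. h q \<noteq> 0 \<and> (f \<circ> \<phi>) q = g q / h q)"
    using open_N p N(2) gh(3)
    by (intro exI[of _ ?N] exI[of _ g'] exI[of _ h']) auto
qed

section \<open>Quotients with a section\<close>

text \<open>The inverse of the induced map \<open>\<Phi>\<close> is \<open>\<sigma>\<close> followed by the projection. Regularity of \<open>f \<circ> T\<close>
  descends to \<open>f\<close> by pulling back along \<open>\<sigma>\<close>, because \<open>f \<circ> T \<circ> \<sigma> = f\<close>.\<close>

lemma variety_iso_quotient_section:
  assumes T_rat: "rational_map_on K S L T" and T_maps: "T ` S \<subseteq> F"
    and \<sigma>_rat: "rational_map_on L F K \<sigma>" and \<sigma>_maps: "\<sigma> ` F \<subseteq> S"
    and T_\<sigma>: "\<And>q. q \<in> F \<Longrightarrow> T (\<sigma> q) = q"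
    and \<sigma>_T: "\<And>p. p \<in> S \<Longrightarrow> r `` {\<sigma> (T p)} = r `` {p}"
    and \<Phi>: "\<And>p. p \<in> S \<Longrightarrow> \<Phi> (r `` {p}) = T p"
  shows "variety_iso (quotient_space (variety K S) r) (variety L F) \<Phi>"
proof -
  let ?X = "quotient_space (variety K S) r"
  have top_variety: "top_of (variety K S) = zariski K S" "top_of (variety L F) = zariski L F"
    and reg_variety: "reg_of (variety K S) = regular_on K" "reg_of (variety L F) = regular_on L"
    by (simp_all add: variety_def)
  have top_X: "topspace (top_of ?X) = S // r"
    by (simp add: topspace_quotient_space top_variety topspace_zariski)
  have open_X: "openin (top_of ?X) V \<longleftrightarrow>
      V \<subseteq> S // r \<and> openin (zariski K S) {p \<in> S. r `` {p} \<in> V}" for V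
    by (simp add: openin_quotient_space quotient_open_def top_variety topspace_zariski)
  have lift: "{p \<in> S. r `` {p} \<in> {c \<in> S // r. \<Phi> c \<in> V}} = {p \<in> S. T p \<in> V}" for V
    using \<Phi> by (auto intro: quotientI)
  have "continuous_map (top_of ?X) (zariski L F) \<Phi>"
    unfolding continuous_map_def
  proof (intro conjI allI impI)
    show "\<Phi> \<in> topspace (top_of ?X) \<rightarrow> topspace (zariski L F)"
      using \<Phi> T_maps by (auto simp: top_X topspace_zariski elim!: quotientE)
    fix V assume "openin (zariski L F) V"
    then have "openin (zariski K S) {p \<in> S. T p \<in> V}"
      using openin_continuous_map_preimage[OF continuous_map_zariski[OF T_rat T_maps]]
      by (simp add: topspace_zariski)
    then show "openin (top_of ?X) {c \<in> topspace (top_of ?X). \<Phi> c \<in> V}"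
      unfolding open_X top_X lift by blast
  qed
  moreover have "continuous_map (zariski L F) (top_of ?X) (\<lambda>q. r `` {\<sigma> q})"
    unfolding continuous_map_def
  proof (intro conjI allI impI)
    show "(\<lambda>q. r `` {\<sigma> q}) \<in> topspace (zariski L F) \<rightarrow> topspace (top_of ?X)"
      using \<sigma>_maps by (auto simp: top_X topspace_zariski intro: quotientI)
    fix V assume "openin (top_of ?X) V"
    then have "openin (zariski K S) {p \<in> S. r `` {p} \<in> V}"
      by (simp add: open_X)
    then have "openin (zariski L F) {q \<in> F. \<sigma> q \<in> {p \<in> S. r `` {p} \<in> V}}"
      using openin_continuous_map_preimage[OF continuous_map_zariski[OF \<sigma>_rat \<sigma>_maps]]
      unfolding topspace_zariski by blast
    also have "{q \<in> F. \<sigma> q \<in> {p \<in> S. r `` {p} \<in> V}} = {q \<in> F. r `` {\<sigma> q} \<in> V}"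
      using \<sigma>_maps by auto
    finally show "openin (zariski L F) {q \<in> topspace (zariski L F). r `` {\<sigma> q} \<in> V}"
      by (simp add: topspace_zariski)
  qed
  moreover have "\<forall>c\<in>S // r. r `` {\<sigma> (\<Phi> c)} = c"
    using \<Phi> \<sigma>_T unfolding quotient_def by (metis (no_types, lifting) UN_E singletonD)
  moreover have "\<forall>q\<in>F. \<Phi> (r `` {\<sigma> q}) = q"
    using \<Phi> T_\<sigma> \<sigma>_maps by (simp add: image_subset_iff)
  ultimately have "homeomorphic_maps (top_of ?X) (zariski L F) \<Phi> (\<lambda>q. r `` {\<sigma> q})"
    unfolding homeomorphic_maps_def by (simp add: top_X topspace_zariski)
  then have homeo: "homeomorphic_map (top_of ?X) (top_of (variety L F)) \<Phi>"
    unfolding homeomorphic_map_maps top_variety by blast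
  have "regular_on L V f \<longleftrightarrow> reg_of ?X {c \<in> topspace (top_of ?X). \<Phi> c \<in> V} (f \<circ> \<Phi>)"
    if "openin (zariski L F) V" for V f
  proof -
    let ?U = "{p \<in> S. T p \<in> V}"
    have "V \<subseteq> F" using openin_subset[OF that] by (simp add: topspace_zariski)
    then have \<sigma>_U: "{q \<in> F. \<sigma> q \<in> ?U} = V"
      using T_\<sigma> \<sigma>_maps by auto
    have "reg_of ?X {c \<in> topspace (top_of ?X). \<Phi> c \<in> V} (f \<circ> \<Phi>) \<longleftrightarrow>
        regular_on K {p \<in> S. r `` {p} \<in> {c \<in> S // r. \<Phi> c \<in> V}} (\<lambda>p. (f \<circ> \<Phi>) (r `` {p}))"
      by (simp only: top_X)
        (simp add: quotient_space_def top_variety reg_variety topspace_zariski)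
    also have "\<dots> \<longleftrightarrow> regular_on K ?U (f \<circ> T)"
      unfolding lift by (rule regular_on_cong) (simp add: \<Phi>)
    also have "\<dots> \<longleftrightarrow> regular_on L V f"
    proof
      assume "regular_on K ?U (f \<circ> T)"
      then have "regular_on L V ((f \<circ> T) \<circ> \<sigma>)"
        using regular_on_pullback[OF \<sigma>_rat] \<sigma>_U by metis
      moreover have "\<And>q. q \<in> V \<Longrightarrow> ((f \<circ> T) \<circ> \<sigma>) q = f q"
        using T_\<sigma> \<open>V \<subseteq> F\<close> by auto
      ultimately show "regular_on L V f"
        using regular_on_cong by blast
    qed (rule regular_on_pullback[OF T_rat])
    finally show ?thesis by blast
  qed
  with homeo show ?thesis
    unfolding variety_iso_def reg_variety top_variety by blast
qed

section \<open>The six coordinates as a polynomial map\<close>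

lemma wild_data_star_iff:
  "(mat2 a b c d, mat2 1 u1 0 1, mat2 1 0 u2 1, mat2 l 0 0 (inverse l)) \<in> wild_data_star \<longleftrightarrow>
     a * d - b * c = 1 \<and> l \<noteq> 0 \<and> u1 \<noteq> 0 \<and> u2 \<noteq> 0 \<and> l \<noteq> 1 \<and> l \<noteq> -1"
  by (auto simp: wild_data_star_def SL2_def)

lemma wild_data_starE:
  assumes "p \<in> wild_data_star"
  obtains a b c d u1 u2 l where "a * d - b * c = 1" "l \<noteq> 0" "u1 \<noteq> 0" "u2 \<noteq> 0" "l \<noteq> 1" "l \<noteq> -1"
    "p = (mat2 a b c d, mat2 1 u1 0 1, mat2 1 0 u2 1, mat2 l 0 0 (inverse l))"
proof -
  obtain M0 u1 u2 l where *: "det M0 = 1" "l \<noteq> 0" "u1 * u2 \<noteq> 0" "l \<noteq> 1" "l \<noteq> -1"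
    "p = (M0, mat2 1 u1 0 1, mat2 1 0 u2 1, mat2 l 0 0 (inverse l))"
    using assms by (auto simp: wild_data_star_def SL2_def)
  obtain a b c d where "M0 = mat2 a b c d" using mat2_eta by blast
  with * that show ?thesis by auto
qed

lemma wild_data_star_subset: "wild_data_star \<subseteq> wild_data"
  unfolding wild_data_star_def wild_data_def by blast

lemma rational_on_stokes_entries:
  "rational_on stokes_coords S (\<lambda>p. fst p $ i $ j)"
  "rational_on stokes_coords S (\<lambda>p. fst (snd p) $ i $ j)"
  "rational_on stokes_coords S (\<lambda>p. fst (snd (snd p)) $ i $ j)"
  "rational_on stokes_coords S (\<lambda>p. snd (snd (snd p)) $ i $ j)"
  unfolding stokes_coords_def case_prod_beta' by (rule rational_on_coord, blast)+

text \<open>On \<open>wild_data\<close> the inverse of \<open>l\<close> is itself an entry, of \<open>Mh\<close>, so no division occurs.\<close>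

lemma rational_map_T_data: "rational_map_on stokes_coords wild_data_star c6_coords T_data"
proof -
  define T' :: "stokes_data \<Rightarrow> c6" where
    "T' = (\<lambda>p. let a = fst p $ 1 $ 1; b = fst p $ 1 $ 2; c = fst p $ 2 $ 1; d = fst p $ 2 $ 2;
        u1 = fst (snd p) $ 1 $ 2; u2 = fst (snd (snd p)) $ 2 $ 1;
        l = snd (snd (snd p)) $ 1 $ 1; k = snd (snd (snd p)) $ 2 $ 2 in
      (l, a + d, l * (a * (1 + u1 * u2) + b * u2) + k * (c * u1 + d), 2 + u1 * u2,
       a * (1 + u1 * u2) + b * u2 + c * u1 + d, a * l + d * k))"
  have "T_data p = T' p" if "p \<in> wild_data_star" for p
    using that
  proof (rule wild_data_starE, goal_cases)
    case (1 a b c d u1 u2 l)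
    then show ?case by (simp add: T_data_mat2 T'_def Let_def)
  qed
  then have "rational_on stokes_coords wild_data_star (\<lambda>p. k (T_data p)) \<longleftrightarrow>
      rational_on stokes_coords wild_data_star (\<lambda>p. k (T' p))" for k
    by (intro rational_on_cong) simp
  moreover have "rational_on stokes_coords wild_data_star (\<lambda>p. k (T' p))" if "k \<in> c6_coords" for k
    using that unfolding c6_coords_def
    by (elim insertE emptyE; simp only: T'_def Let_def case_prod_conv)
      (intro rational_on_intros rational_on_stokes_entries)+
  ultimately show ?thesis
    unfolding rational_map_on_def by blast
qed

section \<open>The section over the cubic\<close>

text \<open>The Fricke relation holds for matrices of determinant 1. Here \<open>U1 U2\<close> and \<open>Mh\<close> have
  determinant 1 but \<open>M0\<close> is arbitrary, so the Fricke polynomial measures the defect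
  \<open>a d - b c - 1\<close>. With \<open>k\<close> for \<open>1/l\<close> and \<open>B\<close>, \<open>C\<close> for \<open>b u2\<close>, \<open>c u1\<close>, so that
  \<open>B C = (s - 2) b c\<close>, the right-hand side is \<open>(l - k)\<^sup>2 (s - 2) (a d - b c - 1)\<close>.\<close>

lemma fricke_factorization:
  fixes a d B C s l k :: complex
  assumes "l * k = 1"
  defines "t0 \<equiv> a + d" and "t1 \<equiv> l * (a * (s - 1) + B) + k * (C + d)"
    and "x \<equiv> a * (s - 1) + B + C + d" and "y \<equiv> a * l + d * k"
  shows "t1^2 - (t0 * (k - l + l * s) + s * y + (l + k) * x - t0 * s * (l + k)) * t1
     + (t0^2 + s^2 + (l + k)^2 + x^2 + (k - l + l * s)^2 + y^2 + x * y * (k - l + l * s)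
     - t0 * s * x - t0 * (l + k) * y - s * (l + k) * (k - l + l * s) - 4)
     = - ((l - k)^2 * (B * C - (s - 2) * (a * d - 1)))"
  using assms(1) unfolding assms(2-) by algebra

text \<open>The representative with \<open>u1 = 1\<close>. The entries solve the two linear systems by Cramer's rule,
  with numerator and denominator multiplied by \<open>l\<close>; \<open>X\<close> and \<open>Z\<close> are the right-hand sides of
  \<open>B + C = X\<close> and \<open>l B + C / l = Z\<close>.\<close>

definition stokes_section :: "c6 \<Rightarrow> stokes_data" where
  "stokes_section = (\<lambda>(l, t0, t1, s, x, y).
     let a = (l * y - t0) / (l * l - 1); d = l * (l * t0 - y) / (l * l - 1);
         X = x - a * (s - 1) - d; Z = t1 - l * (a * (s - 1)) - inverse l * d;
         B = (l * Z - X) / (l * l - 1); C = l * (l * X - Z) / (l * l - 1)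
     in (mat2 a (B / (s - 2)) C d, mat2 1 1 0 1, mat2 1 0 (s - 2) 1, mat2 l 0 0 (inverse l)))"

lemma square_neq_1:
  fixes l :: complex
  assumes "l \<noteq> 1" "l \<noteq> -1"
  shows "l * l - 1 \<noteq> 0"
  using assms by (simp add: square_eq_1_iff)

lemma linear_system_solution:
  fixes l :: complex
  assumes "l \<noteq> 0" "l \<noteq> 1" "l \<noteq> -1"
  shows "v + w = X \<and> l * v + inverse l * w = Z \<longleftrightarrow>
    v = (l * Z - X) / (l * l - 1) \<and> w = l * (l * X - Z) / (l * l - 1)"
proof -
  define m where "m = l * l - 1"
  have m: "m \<noteq> 0" unfolding m_def using assms(2,3) by (rule square_neq_1)
  have "l * v + inverse l * w = Z \<longleftrightarrow> l * l * v + w = l * Z"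
    using assms(1) by (auto simp: field_simps)
  then have "v + w = X \<and> l * v + inverse l * w = Z \<longleftrightarrow> v + w = X \<and> l * l * v + w = l * Z"
    by simp
  also have "\<dots> \<longleftrightarrow> m * v = l * Z - X \<and> m * w = l * (l * X - Z)"
  proof
    assume "m * v = l * Z - X \<and> m * w = l * (l * X - Z)"
    then have "m * (v + w) = m * X" "m * (l * l * v + w) = m * (l * Z)"
      unfolding m_def by algebra+
    with m show "v + w = X \<and> l * l * v + w = l * Z" by simp
  next
    assume "v + w = X \<and> l * l * v + w = l * Z"
    then have "X = v + w" "l * Z = l * l * v + w" by simp_all
    then show "m * v = l * Z - X \<and> m * w = l * (l * X - Z)"
      unfolding m_def by (simp add: algebra_simps)
  qed
  also have "\<dots> \<longleftrightarrow> v = (l * Z - X) / m \<and> w = l * (l * X - Z) / m"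
    using m by (auto simp: field_simps)
  finally show ?thesis unfolding m_def .
qed

text \<open>From left to right, the section satisfies the equations for \<open>t0\<close>, \<open>y\<close>, \<open>x\<close>, \<open>t1\<close>; from right
  to left, a point with \<open>u1 = 1\<close> is recognised as the value of the section at its own
  coordinates. Both linear systems have the same matrix, so one lemma solves them.\<close>

lemma stokes_section_eq_iff:
  fixes l :: complex
  assumes "l \<noteq> 0" "l \<noteq> 1" "l \<noteq> -1" "s \<noteq> 2"
  shows "stokes_section (l, t0, t1, s, x, y) =
      (mat2 a b c d, mat2 1 1 0 1, mat2 1 0 (s - 2) 1, mat2 l 0 0 (inverse l)) \<longleftrightarrow>
    a + d = t0 \<and> l * a + inverse l * d = y \<and>
    b * (s - 2) + c = x - a * (s - 1) - d \<and>
    l * (b * (s - 2)) + inverse l * c = t1 - l * (a * (s - 1)) - inverse l * d"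
proof -
  define a0 where "a0 = (l * y - t0) / (l * l - 1)"
  define d0 where "d0 = l * (l * t0 - y) / (l * l - 1)"
  define X where "X = (\<lambda>a d. x - a * (s - 1) - d)"
  define Z where "Z = (\<lambda>a d. t1 - l * (a * (s - 1)) - inverse l * d)"
  define B0 where "B0 = (\<lambda>a d. (l * Z a d - X a d) / (l * l - 1))"
  define C0 where "C0 = (\<lambda>a d. l * (l * X a d - Z a d) / (l * l - 1))"
  have "stokes_section (l, t0, t1, s, x, y) =
      (mat2 a0 (B0 a0 d0 / (s - 2)) (C0 a0 d0) d0, mat2 1 1 0 1, mat2 1 0 (s - 2) 1,
       mat2 l 0 0 (inverse l))"
    unfolding stokes_section_def case_prod_conv Let_def a0_def d0_def B0_def C0_def X_def Z_def ..
  moreover have "B0 a0 d0 / (s - 2) = b \<longleftrightarrow> b * (s - 2) = B0 a0 d0"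
    using assms(4) by (auto simp: field_simps)
  moreover have "a + d = t0 \<and> l * a + inverse l * d = y \<longleftrightarrow> a = a0 \<and> d = d0"
    unfolding a0_def d0_def by (rule linear_system_solution[OF assms(1-3)])
  moreover have "b * (s - 2) + c = X a d \<and> l * (b * (s - 2)) + inverse l * c = Z a d \<longleftrightarrow>
      b * (s - 2) = B0 a d \<and> c = C0 a d"
    unfolding B0_def C0_def by (rule linear_system_solution[OF assms(1-3)])
  ultimately have "stokes_section (l, t0, t1, s, x, y) =
      (mat2 a b c d, mat2 1 1 0 1, mat2 1 0 (s - 2) 1, mat2 l 0 0 (inverse l)) \<longleftrightarrow>
    (a + d = t0 \<and> l * a + inverse l * d = y) \<and>
    (b * (s - 2) + c = X a d \<and> l * (b * (s - 2)) + inverse l * c = Z a d)"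
    by (simp only: prod.inject mat2_eq_iff) blast
  then show ?thesis
    unfolding X_def Z_def by blast
qed

lemma F_starE:
  assumes "q \<in> F_star"
  obtains l t0 t1 s x y where "q = (l, t0, t1, s, x, y)" "l \<noteq> 0" "l \<noteq> 1" "l \<noteq> -1" "s \<noteq> 2"
    "t1^2 - F_P l t0 s x y * t1 + F_Q l t0 s x y = 0"
  using assms by (auto simp: F_star_def F_cubic_def)

lemma stokes_section_properties:
  assumes "q \<in> F_star"
  shows "stokes_section q \<in> wild_data_star \<and> T_data (stokes_section q) = q"
  using assms
proof (rule F_starE, goal_cases)
  case (1 l t0 t1 s x y)
  define k where "k = inverse l"
  have lk: "l * k = 1" using 1 by (simp add: k_def)
  obtain a b c d where sec: "stokes_section q =
      (mat2 a b c d, mat2 1 1 0 1, mat2 1 0 (s - 2) 1, mat2 l 0 0 (inverse l))"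
    unfolding 1 stokes_section_def Let_def by simp
  then have sys: "a + d = t0" "l * a + k * d = y" "b * (s - 2) + c = x - a * (s - 1) - d"
      "l * (b * (s - 2)) + k * c = t1 - l * (a * (s - 1)) - k * d"
    using stokes_section_eq_iff[OF 1(2-5), of t0 t1 x y a b c d] by (simp_all add: 1(1) k_def)
  have t: "t0 = a + d" "t1 = l * (a * (s - 1) + b * (s - 2)) + k * (c + d)"
      "x = a * (s - 1) + b * (s - 2) + c + d" "y = a * l + d * k"
    using sys by (simp_all add: algebra_simps)
  have "(l - k)^2 * (b * (s - 2) * c - (s - 2) * (a * d - 1)) = 0"
    using 1(6) fricke_factorization[OF lk, where a = a and d = d and s = s
        and B = "b * (s - 2)" and C = c]
    unfolding F_P_def F_Q_def t k_def[symmetric] by simp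
  moreover have "l - k \<noteq> 0"
  proof
    assume "l - k = 0"
    then have "l * l - 1 = 0" using lk by simp
    then show False using square_neq_1[OF 1(3,4)] by contradiction
  qed
  ultimately have "b * (s - 2) * c - (s - 2) * (a * d - 1) = 0"
    by simp
  then have "(s - 2) * (a * d - b * c - 1) = 0"
    by algebra
  with 1(5) have det: "a * d - b * c = 1" by simp
  have "T_data (stokes_section q) = q"
    unfolding sec T_data_mat2[OF det 1(2)] unfolding 1(1) t k_def
    by (simp add: algebra_simps)
  moreover have "stokes_section q \<in> wild_data_star"
    unfolding sec wild_data_star_iff using det 1 by simp
  ultimately show ?case by blast
qed

text \<open>The torus element that moves a point to the section is a square root of \<open>1 / u1\<close>.\<close>

lemma stokes_section_equivalent:
  assumes "l0 \<noteq> 0" "p \<in> wild_data_star"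
  shows "(p, stokes_section (T_data p)) \<in> sim_conj_rel (\<Lambda>0 l0)"
  using assms(2)
proof (rule wild_data_starE, goal_cases)
  case (1 a b c d u1 u2 l)
  define \<alpha> where "\<alpha> = csqrt (inverse u1)"
  have \<alpha>: "\<alpha> \<noteq> 0" "\<alpha>^2 = inverse u1" "inverse \<alpha>^2 = u1"
    using 1 by (simp_all add: \<alpha>_def power_inverse)
  have "stokes_section (T_data p) = (mat2 a (inverse u1 * b) (u1 * c) d, mat2 1 1 0 1,
      mat2 1 0 (2 + u1 * u2 - 2) 1, mat2 l 0 0 (inverse l))"
    unfolding 1(7) T_data_mat2[OF 1(1,2)]
    by (subst stokes_section_eq_iff) (use 1 in \<open>simp_all add: field_simps\<close>)
  also have "\<dots> = (mat2 a (\<alpha>^2 * b) (inverse \<alpha>^2 * c) d, mat2 1 (\<alpha>^2 * u1) 0 1,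
      mat2 1 0 (inverse \<alpha>^2 * u2) 1, mat2 l 0 0 (inverse l))"
    unfolding \<alpha> using 1(3) by simp
  finally show ?case
    unfolding 1(7) using sim_conj_relI[OF assms(1) 1(1,2) \<alpha>(1), of u1 u2] by simp
qed

lemma T_data_in_F_star:
  assumes "p \<in> wild_data_star"
  shows "T_data p \<in> F_star"
proof -
  have "T_data p \<in> F_cubic"
    using assms wild_data_star_subset by (blast intro: T_data_in_F)
  with assms show ?thesis
    by (elim wild_data_starE) (auto simp: T_data_mat2 F_star_def)
qed

lemma rational_on_c6_coords:
  "rational_on c6_coords S (\<lambda>q. fst q)"
  "rational_on c6_coords S (\<lambda>q. fst (snd q))"
  "rational_on c6_coords S (\<lambda>q. fst (snd (snd q)))"
  "rational_on c6_coords S (\<lambda>q. fst (snd (snd (snd q))))"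
  "rational_on c6_coords S (\<lambda>q. fst (snd (snd (snd (snd q)))))"
  "rational_on c6_coords S (\<lambda>q. snd (snd (snd (snd (snd q)))))"
  unfolding c6_coords_def case_prod_beta' by (rule rational_on_coord, blast)+

lemma rational_map_stokes_section: "rational_map_on c6_coords F_star stokes_coords stokes_section"
proof -
  have nz: "fst q \<noteq> 0" "fst q * fst q - 1 \<noteq> 0" "fst (snd (snd (snd q))) - 2 \<noteq> 0"
    if "q \<in> F_star" for q
    using that by (auto elim!: F_starE dest: square_neq_1)
  note intros = rational_on_intros rational_on_c6_coords rational_on_divide rational_on_inverse nz
  have "\<forall>i j. rational_on c6_coords F_star (\<lambda>q. fst (stokes_section q) $ i $ j)"
    "\<forall>i j. rational_on c6_coords F_star (\<lambda>q. fst (snd (stokes_section q)) $ i $ j)"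
    "\<forall>i j. rational_on c6_coords F_star (\<lambda>q. fst (snd (snd (stokes_section q))) $ i $ j)"
    "\<forall>i j. rational_on c6_coords F_star (\<lambda>q. snd (snd (snd (stokes_section q))) $ i $ j)"
    unfolding forall_2 stokes_section_def Let_def case_prod_beta' fst_conv snd_conv mat2_nth
    by (intro conjI intros; assumption?)+
  then show ?thesis
    unfolding rational_map_on_def stokes_coords_def case_prod_beta' by blast
qed

section \<open>The isomorphism\<close>

theorem proposition3p11:
  fixes l0 :: complex
  assumes "l0 \<noteq> 0"
  shows "variety_iso (chi_star_space (\<Lambda>0 l0)) F_star_space T_map"
  unfolding chi_star_space_def F_star_space_def
proof (rule variety_iso_quotient_section[where T = T_data and \<sigma> = stokes_section])
  fix p assume p: "p \<in> wild_data_star"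
  show "sim_conj_rel (\<Lambda>0 l0) `` {stokes_section (T_data p)} = sim_conj_rel (\<Lambda>0 l0) `` {p}"
    using equiv_class_eq[OF equiv_sim_conj_rel[OF assms] stokes_section_equivalent[OF assms p]]
    by simp
  show "T_map (sim_conj_rel (\<Lambda>0 l0) `` {p}) = T_data p"
    using p wild_data_star_subset by (intro T_class assms) blast
qed (use stokes_section_properties T_data_in_F_star rational_map_T_data
    rational_map_stokes_section in auto)

end
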